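(* Let $|D_q\rangle=\bigotimes_{i=1}^q\bigl(|x_i\rangle_C\otimes|\psi_{f(x_i)}\rangle_R\bigr)$ denote the adversary's database of $q$ random challenge–response pairs generated from a hybrid PUF $\mathcal E_f:\{0,1\}^n\to(\mathcal H^2)^{\otimes m}$. If $\tilde D_q$ denotes the noisy classical response set that is extracted from $|D_q\rangle$ such that $\mathrm{dist}(D_q,\tilde D_q)\le\varepsilon$ with probability $p_{\mathrm{extract}}$, then $$p_{\mathrm{extract}}\ \le\ \sum_{k=(1-\varepsilon)q}^{q}\binom{q}{k}\,(p_{\mathrm{guess}})^{2mk}\,\bigl(1-(p_{\mathrm{guess}})^{2m}\bigr)^{q-k},$$ where $p_{\mathrm{guess}}\le p(1+\sqrt2\,p)$ is the optimal probability of guessing a value bit of the classical PUF from a single copy of the corresponding output qubit.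
   Context: **Classical PUF.** $f:\{0,1\}^n\to\{0,1\}^{2m}$ is a classical PUF (a probabilistic function). Standing assumptions: for every input $x$ the output bits $f(x)_1,\dots,f(x)_{2m}$ are independent and identically distributed, each equal to $0$ with probability $p=\frac12+\delta_r$, $0\le\delta_r\le\frac12$; the output distributions for all inputs $x$ are independent and identically distributed. **Hybrid PUF.** Writing $f(x)=y_1\dots y_{2m}$, the hybrid PUF maps $x$ to $|\psi_{f(x)}\rangle=\bigotimes_{j=1}^m|\psi^j\rangle$, where $(y_{2j-1},y_{2j})=(0,0),(1,0),(0,1),(1,1)$ is encoded as $|0\rangle,|1\rangle,|+\rangle,|-\rangle$ respectively ($y_{2j}$ is the basis bit, $y_{2j-1}$ the value bit). **Database and distance.** The challenges $x_i$ are uniformly random and one copy of each response state is given. $D_q=\{f(x_i)\}_{1\le i\le q}$, $\tilde D_q=\{\tilde f(x_i)\}_{1\le i\le q}$ is the result of the adversary's extraction, and $\mathrm{dist}(\tilde D_q,D_q)=\frac1q\,\#\{i:\tilde f(x_i)\ne f(x_i)\}$; $0\le\varepsilon\le1$. **Guessing probability.** $p_{\mathrm{guess}}$ is the optimal probability, over quantum adversaries, of outputting the value bit $y_{2j-1}$ given the challenge $x$ and a single copy of the qubit $|\psi^j\rangle$.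
   Formalization: The q random challenges are taken uniformly among families of pairwise distinct challenges (so q ≤ 2^n), making "one copy of each response state" literal; with repeated challenges the adversary holds several copies of a state and the bound can fail. *)

theory Defs
  imports "HOL-Probability.Probability"
begin

text \<open>
  The numbers \<open>n\<close>, \<open>m\<close>, \<open>q\<close> are the cardinalities of finite index types \<open>'n\<close>, \<open>'m\<close>, \<open>'q\<close>.
  Bits are booleans with \<open>True\<close> for \<open>1\<close>.  A string \<open>y\<close> of \<open>2m\<close> bits is stored as \<open>m\<close> pairs:
  the pair at \<open>j\<close> is \<open>(y\<^bsub>2j-1\<^esub>, y\<^bsub>2j\<^esub>)\<close>, i.e. (value bit, basis bit).
\<close>

type_synonym 'n challenge = "'n \<Rightarrow> bool"
type_synonym 'm response = "'m \<Rightarrow> bool \<times> bool"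

type_synonym 'i ket = "complex ^ 'i"
type_synonym 'i operator = "complex ^ 'i ^ 'i"


subsection \<open>Finite-dimensional quantum mechanics\<close>

definition cinner :: "'i::finite ket \<Rightarrow> 'i ket \<Rightarrow> complex" where
  "cinner u v = (\<Sum>i\<in>UNIV. cnj (u $ i) * v $ i)"

definition positive_op :: "'i::finite operator \<Rightarrow> bool" where
  "positive_op A \<longleftrightarrow>
     (\<forall>v. Im (cinner v (A *v v)) = 0 \<and> 0 \<le> Re (cinner v (A *v v)))"

definition povm :: "('o::finite \<Rightarrow> 'i::finite operator) \<Rightarrow> bool" where
  "povm M \<longleftrightarrow> (\<forall>a. positive_op (M a)) \<and> (\<Sum>a\<in>UNIV. M a) = mat 1"

definition born :: "'i::finite operator \<Rightarrow> 'i ket \<Rightarrow> real" where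
  "born A \<psi> = Re (cinner \<psi> (A *v \<psi>))"

definition tensor :: "'a::finite ket \<Rightarrow> 'b::finite ket \<Rightarrow> ('a \<times> 'b) ket" where
  "tensor u v = (\<chi> i. u $ fst i * v $ snd i)"

text \<open>The tensor product of a finite family; its computational basis consists of the
  functions selecting a basis label in each factor.\<close>

definition Tensor :: "('k::finite \<Rightarrow> 'a::finite ket) \<Rightarrow> ('k \<Rightarrow> 'a) ket" where
  "Tensor u = (\<chi> b. \<Prod>k\<in>UNIV. u k $ b k)"

abbreviation basis_ket :: "'a::finite \<Rightarrow> 'a ket" where
  "basis_ket a \<equiv> axis a 1"

definition ket_plus :: "bool ket" where
  "ket_plus = (\<chi> b. complex_of_real (1 / sqrt 2))"

definition ket_minus :: "bool ket" where
  "ket_minus = (\<chi> b. complex_of_real ((if b then - 1 else 1) / sqrt 2))"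


subsection \<open>Classical and hybrid PUFs\<close>

text \<open>The law of \<open>f\<close>: all bits of all outputs are independent, each \<open>0\<close> with probability \<open>p\<close>.
  (Because the index sets are \<open>UNIV\<close>, the default argument of \<^const>\<open>Pi_pmf\<close> is irrelevant.)\<close>

definition puf_bit :: "real \<Rightarrow> bool pmf" where
  "puf_bit p = bernoulli_pmf (1 - p)"

definition classical_puf :: "real \<Rightarrow> ('n::finite challenge \<Rightarrow> 'm::finite response) pmf" where
  "classical_puf p =
     Pi_pmf UNIV undefined
       (\<lambda>x. Pi_pmf UNIV undefined (\<lambda>j. pair_pmf (puf_bit p) (puf_bit p)))"

fun encode :: "bool \<times> bool \<Rightarrow> bool ket" where
  "encode (False, False) = basis_ket False"
| "encode (True,  False) = basis_ket True"
| "encode (False, True)  = ket_plus"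
| "encode (True,  True)  = ket_minus"

definition hybrid_state :: "'m::finite response \<Rightarrow> ('m \<Rightarrow> bool) ket" where
  "hybrid_state y = Tensor (\<lambda>j. encode (y j))"

definition database ::
    "('q::finite \<Rightarrow> 'n::finite challenge) \<Rightarrow> ('n challenge \<Rightarrow> 'm::finite response)
       \<Rightarrow> ('q \<Rightarrow> 'n challenge \<times> ('m \<Rightarrow> bool)) ket" where
  "database x f = Tensor (\<lambda>i. tensor (basis_ket (x i)) (hybrid_state (f (x i))))"


subsection \<open>Extraction and guessing\<close>

definition db_dist :: "('q::finite \<Rightarrow> 'm response) \<Rightarrow> ('q \<Rightarrow> 'm response) \<Rightarrow> real" where
  "db_dist D' D = real (card {i. D' i \<noteq> D i}) / real CARD('q)"

text \<open>One copy of each response state is given, so the random challenges are pairwise distinct: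
  they are uniform among the injective families (there are such families iff
  \<open>q \<le> 2 ^ n\<close>).  With repeated challenges the adversary would hold several copies of the
  same response state.\<close>

definition challenges :: "('q::finite \<Rightarrow> 'n::finite challenge) pmf" where
  "challenges = pmf_of_set {x. inj x}"

text \<open>The adversary is an arbitrary joint measurement on all of \<open>|D\<^sub>q\<rangle>\<close> whose outcome is the
  family of guessed responses.\<close>

definition p_extract ::
    "real \<Rightarrow> real
       \<Rightarrow> (('q::finite \<Rightarrow> 'm::finite response)
             \<Rightarrow> ('q \<Rightarrow> 'n::finite challenge \<times> ('m \<Rightarrow> bool)) operator)
       \<Rightarrow> real" where
  "p_extract p \<epsilon> M =
     measure_pmf.expectation (pair_pmf challenges (classical_puf p))
       (\<lambda>(x, f). \<Sum>D' | db_dist D' (\<lambda>i. f (x i)) \<le> \<epsilon>. born (M D') (database x f))"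

text \<open>The optimum over all measurements on the challenge and the \<open>j\<close>-th response qubit whose
  outcome is the guessed value bit.\<close>

definition p_guess :: "real \<Rightarrow> 'n::finite challenge \<Rightarrow> 'm::finite \<Rightarrow> real" where
  "p_guess p x j =
     (SUP M \<in> {M :: bool \<Rightarrow> ('n challenge \<times> bool) operator. povm M}.
        measure_pmf.expectation
          (classical_puf p :: ('n challenge \<Rightarrow> 'm response) pmf)
          (\<lambda>f. born (M (fst (f x j))) (tensor (basis_ket x) (encode (f x j)))))"

end

theory Submission
  imports Defs "HOL-Library.Function_Algebras"
begin

text \<open>
  For one qubit let \<open>A\<^sub>y\<close> be the state encoding the bit pair \<open>y\<close>, weighted by its probability, and
  let \<open>K = p\<^sup>2 |0\<rangle>\<langle>0| + p (1 - p) |1\<rangle>\<langle>1|\<close>.  Then \<open>A\<^sub>y \<le> K \<le> \<Sum>\<^sub>y A\<^sub>y\<close> for every \<open>y\<close> because \<open>p \<ge> 1/2\<close>, and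
  the same holds for the tensor powers that describe one response.  The operator for ``at least
  \<open>t\<close> of the \<open>q\<close> responses agree with a given guess'' is a sum of tensor products of \<open>A\<close> and
  \<open>\<Sum> A - A\<close>; it is increasing in each \<open>A\<close>, so it is dominated by the operator with \<open>A\<close> replaced by
  \<open>K\<close>, which does not depend on the guess.  Hence every joint measurement succeeds with probability
  at most the trace of the latter, the binomial tail with parameter \<open>(tr K)\<^sup>m = p\<^sup>m\<close>.  The Helstrom
  bound gives \<open>p\<^bsub>guess\<^esub> = (1 + \<surd>(p\<^sup>2 + (1 - p)\<^sup>2)) / 2\<close>, so \<open>p \<le> p\<^bsub>guess\<^esub>\<^sup>2\<close>, and the tail is monotone.

  Positive semidefinite operators are handled as kernels on the index set of the basis: under
  pointwise multiplication they form a commutative ring, in which the positive ones are a cone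
  closed under products (Schur), and tensor products are products of pulled-back kernels.
\<close>

subsection \<open>Threshold sums in a positive cone\<close>

text \<open>Generating sum for "at least \<open>t\<close> successes", with \<open>X i\<close> the
  weight of success and \<open>R i\<close> the total weight at \<open>i\<close>. It lives in a
  commutative ring, so that it serves for numbers and for kernels alike.\<close>

definition threshold :: "'s set \<Rightarrow> ('s \<Rightarrow> 'a::comm_ring_1) \<Rightarrow> ('s \<Rightarrow> 'a) \<Rightarrow> nat \<Rightarrow> 'a" where
  "threshold S R X t =
     (\<Sum>T | T \<subseteq> S \<and> t \<le> card T. (\<Prod>i\<in>T. X i) * (\<Prod>i\<in>S - T. R i - X i))"

lemma threshold_insert:
  assumes "finite S" "u \<notin> S"
  shows "threshold (insert u S) R X t
           = X u * threshold S R X (t - 1) + (R u - X u) * threshold S R X t"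
proof -
  let ?f = "\<lambda>S T. (\<Prod>i\<in>T. X i) * (\<Prod>i\<in>S - T. R i - X i)"
  let ?A = "{T. T \<subseteq> S \<and> t \<le> card T}" and ?B = "{T. T \<subseteq> S \<and> t - 1 \<le> card T}"
  have fin: "finite T" if "T \<subseteq> S" for T
    using assms(1) that by (rule rev_finite_subset)
  \<comment> \<open>Split by whether \<open>u\<close> is in \<open>T\<close>. At
    \<open>t = 0\<close> truncated subtraction gives \<open>t - 1 = 0\<close>, which is right:
    neither family is then restricted.\<close>
  have split: "{T. T \<subseteq> insert u S \<and> t \<le> card T} = ?A \<union> insert u ` ?B" (is "?L = ?R")
  proof
    show "?L \<subseteq> ?R"
    proof
      fix T assume T: "T \<in> ?L"
      show "T \<in> ?R"
      proof (cases "u \<in> T")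
        case True
        then have eq: "T = insert u (T - {u})" by auto
        have "finite T" using T assms(1) by (auto intro: finite_subset)
        then have "T - {u} \<in> ?B" using T True by auto
        then show ?thesis using eq by blast
      qed (use T in auto)
    qed
    show "?R \<subseteq> ?L"
    proof
      fix T assume "T \<in> ?R"
      then consider "T \<in> ?A" | T' where "T' \<in> ?B" "T = insert u T'" by blast
      then show "T \<in> ?L"
      proof cases
        case 2
        then have "card T = Suc (card T')" using fin[of T'] assms(2) by (auto simp: card_insert_if)
        then show ?thesis using 2 by auto
      qed auto
    qed
  qed
  have "threshold (insert u S) R X t = sum (?f (insert u S)) ?A + sum (?f (insert u S)) (insert u ` ?B)"
    unfolding threshold_def split
    using assms by (intro sum.union_disjoint) auto
  also have "sum (?f (insert u S)) ?A = (R u - X u) * threshold S R X t"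
    unfolding threshold_def sum_distrib_left
  proof (rule sum.cong)
    fix T assume T: "T \<in> ?A"
    then have "insert u S - T = insert u (S - T)" using assms(2) by auto
    then show "?f (insert u S) T = (R u - X u) * ?f S T"
      using assms by (simp add: mult.left_commute)
  qed simp
  also have "sum (?f (insert u S)) (insert u ` ?B) = sum (\<lambda>T. ?f (insert u S) (insert u T)) ?B"
    using assms(2) by (intro sum.reindex[unfolded comp_def]) (auto simp: inj_on_def dest: insert_ident)
  also have "\<dots> = X u * threshold S R X (t - 1)"
    unfolding threshold_def sum_distrib_left
  proof (rule sum.cong)
    fix T assume T: "T \<in> ?B"
    then have "insert u S - insert u T = S - T" "u \<notin> T" using assms(2) by auto
    then show "?f (insert u S) (insert u T) = X u * ?f S T"
      using fin T by (simp add: mult.assoc)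
  qed simp
  finally show ?thesis by (simp add: add.commute)
qed

text \<open>The order is expressed as \<open>P (y - x)\<close>. The instances are the nonnegative
  reals and the positive kernels, so one monotonicity proof covers both.\<close>

locale positive_cone =
  fixes P :: "'a::comm_ring_1 \<Rightarrow> bool"
  assumes zero: "P 0" and one: "P 1"
    and add: "P x \<Longrightarrow> P y \<Longrightarrow> P (x + y)"
    and mult: "P x \<Longrightarrow> P y \<Longrightarrow> P (x * y)"
begin

lemma sum: "(\<And>i. i \<in> S \<Longrightarrow> P (f i)) \<Longrightarrow> P (sum f S)"
  by (induction S rule: infinite_finite_induct) (auto intro: zero add)

lemma prod: "(\<And>i. i \<in> S \<Longrightarrow> P (f i)) \<Longrightarrow> P (prod f S)"
  by (induction S rule: infinite_finite_induct) (auto intro: one mult)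

lemma trans: "P (y - x) \<Longrightarrow> P (z - y) \<Longrightarrow> P (z - x)"
  using add[of "z - y" "y - x"] by simp

lemma prod_mono:
  assumes "\<And>i. i \<in> S \<Longrightarrow> P (f i)" "\<And>i. i \<in> S \<Longrightarrow> P (g i - f i)"
  shows "P (prod g S - prod f S)"
  using assms
proof (induction S rule: infinite_finite_induct)
  case (insert u S)
  have g: "P (g i)" if "i \<in> insert u S" for i
    using add[of "g i - f i" "f i"] insert.prems that by simp
  \<comment> \<open>Telescoping of \<open>g u * prod g S - f u * prod f S\<close>.\<close>
  have "P (g u * (prod g S - prod f S) + (g u - f u) * prod f S)"
    using insert g by (intro add mult prod) auto
  then show ?case using insert.hyps by (simp add: algebra_simps)
qed (simp_all add: zero)

text \<open>Replacing a single factor \<open>X u\<close> by \<open>K u\<close> changes the threshold sum by \<open>K u - X u\<close>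
  times the part in which exactly \<open>t - 1\<close> of the other factors succeed.\<close>

lemma threshold_mono:
  assumes "finite S"
    and "\<And>i. i \<in> S \<Longrightarrow> P (X i)" "\<And>i. i \<in> S \<Longrightarrow> P (K i - X i)" "\<And>i. i \<in> S \<Longrightarrow> P (R i - K i)"
  shows "P (threshold S R K t - threshold S R X t)"
  using assms
proof (induction S arbitrary: t rule: finite_induct)
  case (insert u S)
  let ?K = "threshold S R K" and ?X = "threshold S R X"
  have K: "P (K u)" using add[of "K u - X u" "X u"] insert.prems by simp
  have RX: "P (R i - X i)" if "i \<in> S" for i
    using trans[of "K i" "X i" "R i"] insert.prems that by simp
  have fin: "finite {T. T \<subseteq> S \<and> s \<le> card T}" for s
    using insert.hyps(1) by simp
  \<comment> \<open>Only the sets with exactly \<open>t - 1\<close> elements survive (none if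
    \<open>t = 0\<close>), and each contributes a product of positive factors.\<close>
  have exact: "P (?X (t - 1) - ?X t)"
    unfolding threshold_def
    by (subst sum_diff[symmetric]) (use fin insert.prems RX in \<open>auto intro!: sum mult prod\<close>)
  have "P (K u * (?K (t - 1) - ?X (t - 1)) + (R u - K u) * (?K t - ?X t)
           + (K u - X u) * (?X (t - 1) - ?X t))"
    using insert K exact by (intro add mult) auto
  then show ?case
    using insert.hyps by (simp add: threshold_insert algebra_simps)
qed (simp add: threshold_def zero)

end

interpretation nonneg: positive_cone "\<lambda>x::real. 0 \<le> x"
  by unfold_locales auto

lemma threshold_const:
  "threshold (UNIV :: 's::finite set) (\<lambda>_. 1) (\<lambda>_. P) t
     = (\<Sum>k = t..CARD('s). of_nat (CARD('s) choose k) * P ^ k * (1 - P) ^ (CARD('s) - k))"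
proof -
  let ?N = "CARD('s)"
  have "threshold (UNIV :: 's set) (\<lambda>_. 1) (\<lambda>_. P) t
      = (\<Sum>T | t \<le> card (T :: 's set). P ^ card T * (1 - P) ^ (?N - card T))"
    unfolding threshold_def by (intro sum.cong) (auto simp: card_Diff_subset)
  also have "\<dots> = (\<Sum>k\<in>{t..?N}. \<Sum>T | T \<in> {T :: 's set. t \<le> card T} \<and> card T = k.
                     P ^ card T * (1 - P) ^ (?N - card T))"
    by (rule sum.group[symmetric]) (auto intro: card_mono[OF finite_class.finite_UNIV subset_UNIV])
  also have "\<dots> = (\<Sum>k = t..?N. of_nat (?N choose k) * P ^ k * (1 - P) ^ (?N - k))"
  proof (rule sum.cong)
    fix k assume k: "k \<in> {t..?N}"
    then have eq: "{T. T \<in> {T :: 's set. t \<le> card T} \<and> card T = k} = {T. T \<subseteq> UNIV \<and> card T = k}"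
      by auto
    show "(\<Sum>T | T \<in> {T :: 's set. t \<le> card T} \<and> card T = k. P ^ card T * (1 - P) ^ (?N - card T))
       = of_nat (?N choose k) * P ^ k * (1 - P) ^ (?N - k)"
      unfolding eq by (simp add: n_subsets[of "UNIV :: 's set", simplified] mult.assoc)
  qed simp
  finally show ?thesis .
qed


subsection \<open>Positive semidefinite kernels\<close>

text \<open>Finite sums of rank-one kernels: positivity is built in as a decomposition, so closure
  properties follow by induction.\<close>

inductive gram :: "('b \<Rightarrow> 'b \<Rightarrow> complex) \<Rightarrow> bool" where
  rank_one: "gram (\<lambda>b c. v b * cnj (v c))"
| add: "gram G \<Longrightarrow> gram H \<Longrightarrow> gram (\<lambda>b c. G b c + H b c)"

lemma gram_pullback:
  assumes "gram G"
  shows "gram (\<lambda>b c. G (h b) (h c))"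
  using assms
proof induction
  case (rank_one v)
  show ?case by (rule gram.rank_one[of "\<lambda>b. v (h b)"])
next
  case (add G H)
  then show ?case using gram.add[OF add.IH] by simp
qed

text \<open>Schur product theorem: the entrywise product of the rank-one kernels of \<open>v\<close>
  and \<open>w\<close> is the rank-one kernel of the entrywise product of \<open>v\<close> and
  \<open>w\<close>.\<close>

lemma gram_mult:
  assumes "gram G" "gram H"
  shows "gram (G * H)"
  using assms(1)
proof induction
  case (rank_one v)
  show ?case
    using assms(2)
  proof induction
    case (rank_one w)
    show ?case
      using gram.rank_one[of "\<lambda>b. v b * w b"] by (simp add: times_fun_def mult_ac)
  qed (use gram.add in \<open>simp add: times_fun_def distrib_left\<close>)
qed (use gram.add in \<open>simp add: times_fun_def distrib_right\<close>)

interpretation gram_cone: positive_cone gram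
proof
  show "gram (0 :: 'a \<Rightarrow> 'a \<Rightarrow> complex)"
    using gram.rank_one[of "\<lambda>_ :: 'a. 0"] by (simp add: zero_fun_def)
  show "gram (1 :: 'a \<Rightarrow> 'a \<Rightarrow> complex)"
    using gram.rank_one[of "\<lambda>_ :: 'a. 1"] by (simp add: one_fun_def)
qed (auto intro: gram.add gram_mult simp: plus_fun_def)

lemma gram_scale:
  assumes "0 \<le> w" "gram G"
  shows "gram (\<lambda>b c. complex_of_real w * G b c)"
proof -
  have "gram (\<lambda>b c. complex_of_real w)"
    using gram.rank_one[of "\<lambda>_. complex_of_real (sqrt w)"] assms(1)
    by (simp flip: of_real_mult)
  from gram_mult[OF this assms(2)] show ?thesis by (simp add: times_fun_def)
qed

lemma sum_fun_apply: "sum f S b = (\<Sum>i\<in>S. f i b)" for f :: "'s \<Rightarrow> 'b \<Rightarrow> 'a::comm_monoid_add"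
  by (induction S rule: infinite_finite_induct) auto

lemma prod_fun_apply: "prod f S b = (\<Prod>i\<in>S. f i b)" for f :: "'s \<Rightarrow> 'b \<Rightarrow> 'a::comm_monoid_mult"
  by (induction S rule: infinite_finite_induct) auto

text \<open>All one-qubit operators that occur are real symmetric, so two diagonal entries and one
  off-diagonal entry describe them.\<close>

definition bool_kernel :: "real \<Rightarrow> real \<Rightarrow> real \<Rightarrow> bool \<Rightarrow> bool \<Rightarrow> complex" where
  "bool_kernel x y z b c = complex_of_real (if b = c then if b then y else x else z)"

lemma gram_bool_kernel:
  assumes "0 \<le> x" "0 \<le> y" "z\<^sup>2 \<le> x * y"
  shows "gram (bool_kernel x y z)"
proof (cases "x = 0")
  case True
  then have z: "z = 0" using assms(3) by simp
  have "gram (\<lambda>b c. complex_of_real (if b then sqrt y else 0) * cnj (complex_of_real (if c then sqrt y else 0)))"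
    by (rule gram.rank_one)
  also have "(\<lambda>b c. complex_of_real (if b then sqrt y else 0) * cnj (complex_of_real (if c then sqrt y else 0)))
     = bool_kernel x y z"
    using True z assms(2) by (auto simp: bool_kernel_def fun_eq_iff simp flip: of_real_mult)
  finally show ?thesis .
next
  case False
  then have x: "0 < x" using assms(1) by simp
  \<comment> \<open>The Schur complement of \<open>x\<close>; with it the Cholesky factorization
    writes the matrix as two rank-one terms.\<close>
  define d where "d = y - z\<^sup>2 / x"
  have d: "0 \<le> d" using assms(3) x by (simp add: d_def field_simps)
  let ?v = "\<lambda>b. complex_of_real (if b then z / sqrt x else sqrt x)"
  let ?w = "\<lambda>b. complex_of_real (if b then sqrt d else 0)"
  have "gram ((\<lambda>b c. ?v b * cnj (?v c)) + (\<lambda>b c. ?w b * cnj (?w c)))"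
    unfolding plus_fun_def by (intro gram.add gram.rank_one)
  also have "(\<lambda>b c. ?v b * cnj (?v c)) + (\<lambda>b c. ?w b * cnj (?w c)) = bool_kernel x y z"
  proof (intro ext)
    fix b c
    have "(if b then z / sqrt x else sqrt x) * (if c then z / sqrt x else sqrt x)
        + (if b then sqrt d else 0) * (if c then sqrt d else 0)
      = (if b = c then if b then y else x else z)"
      using x d by (auto simp: d_def power2_eq_square)
    then show "((\<lambda>b c. ?v b * cnj (?v c)) + (\<lambda>b c. ?w b * cnj (?w c))) b c = bool_kernel x y z b c"
      unfolding bool_kernel_def plus_fun_apply complex_cnj_complex_of_real of_real_mult[symmetric]
        of_real_add[symmetric] by simp
  qed
  finally show ?thesis .
qed

lemma bool_kernel_diff:
  "bool_kernel x y z - bool_kernel x' y' z' = bool_kernel (x - x') (y - y') (z - z')"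
  by (auto simp: bool_kernel_def fun_eq_iff)

lemma bool_kernel_add:
  "bool_kernel x y z + bool_kernel x' y' z' = bool_kernel (x + x') (y + y') (z + z')"
  by (auto simp: bool_kernel_def fun_eq_iff)


subsection \<open>Measurements\<close>

text \<open>The real part of tr(A G), i.e. the Born rule extended to unnormalized mixed states
  \<open>G\<close>.\<close>

definition pairing :: "'i::finite operator \<Rightarrow> ('i \<Rightarrow> 'i \<Rightarrow> complex) \<Rightarrow> real" where
  "pairing A G = Re (\<Sum>b\<in>UNIV. \<Sum>c\<in>UNIV. A $ b $ c * G c b)"

definition state_kernel :: "real \<Rightarrow> 'i::finite ket \<Rightarrow> 'i \<Rightarrow> 'i \<Rightarrow> complex" where
  "state_kernel w \<psi> b c = complex_of_real w * (\<psi> $ b * cnj (\<psi> $ c))"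

lemma gram_state_kernel: "0 \<le> w \<Longrightarrow> gram (state_kernel w \<psi>)"
  unfolding state_kernel_def[abs_def] by (intro gram_scale gram.rank_one)

lemma pairing_add: "pairing A (G + H) = pairing A G + pairing A H"
  by (simp add: pairing_def sum.distrib distrib_left)

lemma pairing_diff: "pairing A (G - H) = pairing A G - pairing A H"
  by (simp add: pairing_def sum_subtractf right_diff_distrib)

lemma pairing_sum: "pairing A (sum G S) = (\<Sum>i\<in>S. pairing A (G i))"
proof -
  have "pairing A 0 = 0" by (simp add: pairing_def)
  then show ?thesis by (induction S rule: infinite_finite_induct) (auto simp: pairing_add)
qed

lemma sum_pairing: "(\<Sum>a\<in>S. pairing (M a) G) = pairing (sum M S) G"
proof -
  have "pairing 0 G = 0" "pairing (A + B) G = pairing A G + pairing B G" for A B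
    by (auto simp: pairing_def sum.distrib distrib_right)
  then show ?thesis by (induction S rule: infinite_finite_induct) auto
qed

lemma pairing_one: "pairing (mat 1) G = Re (\<Sum>b\<in>UNIV. G b b)"
  by (simp add: pairing_def mat_def if_distrib[of "\<lambda>x. x * _"] cong: if_cong)

lemma pairing_state_kernel: "pairing A (state_kernel w \<psi>) = w * born A \<psi>"
proof -
  have "(\<Sum>b\<in>UNIV. \<Sum>c\<in>UNIV. A $ b $ c * state_kernel w \<psi> c b)
      = complex_of_real w * cinner \<psi> (A *v \<psi>)"
    by (simp add: state_kernel_def cinner_def matrix_vector_mult_def sum_distrib_left mult_ac)
  then show ?thesis by (simp add: pairing_def born_def)
qed

lemma pairing_nonneg:
  assumes "positive_op A" "gram G"
  shows "0 \<le> pairing A G"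
  using assms(2)
proof induction
  case (rank_one v)
  have "(\<lambda>b c. v b * cnj (v c)) = state_kernel 1 (\<chi> b. v b)"
    by (simp add: state_kernel_def fun_eq_iff)
  then show ?case
    using assms(1) by (simp add: pairing_state_kernel born_def positive_op_def)
qed (simp add: pairing_add[unfolded plus_fun_def])

text \<open>Weak duality for state discrimination: replace every \<open>S a\<close> by the
  dominating \<open>L\<close>; then completeness of the measurement leaves the trace of
  \<open>L\<close>.\<close>

lemma povm_pairing_le_trace:
  assumes "povm M" "\<And>a. gram (L - S a)"
  shows "(\<Sum>a\<in>UNIV. pairing (M a) (S a)) \<le> Re (\<Sum>b\<in>UNIV. L b b)"
proof -
  have "pairing (M a) (S a) \<le> pairing (M a) L" for a
    using pairing_nonneg[of "M a" "L - S a"] assms by (simp add: povm_def pairing_diff)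
  then have "(\<Sum>a\<in>UNIV. pairing (M a) (S a)) \<le> (\<Sum>a\<in>UNIV. pairing (M a) L)"
    by (intro sum_mono)
  also have "\<dots> = Re (\<Sum>b\<in>UNIV. L b b)"
    using assms(1) by (simp add: sum_pairing povm_def pairing_one)
  finally show ?thesis .
qed

lemma positive_op_gram:
  assumes "gram G"
  shows "positive_op (\<chi> b c. G b c)"
  using assms
proof induction
  case (rank_one u)
  have "\<exists>z. cinner v ((\<chi> b c. u b * cnj (u c)) *v v) = cnj z * z" for v
  proof
    let ?z = "\<Sum>c\<in>UNIV. cnj (u c) * v $ c"
    show "cinner v ((\<chi> b c. u b * cnj (u c)) *v v) = cnj ?z * ?z"
      unfolding cinner_def matrix_vector_mult_def
      by (simp add: sum_distrib_left sum_distrib_right mult_ac) (subst sum.swap, simp add: mult_ac)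
  qed
  moreover have "Im (cnj z * z) = 0 \<and> 0 \<le> Re (cnj z * z)" for z :: complex
    by simp
  ultimately show ?case
    unfolding positive_op_def by metis
next
  case (add G H)
  have "cinner v ((\<chi> b c. G b c + H b c) *v v) = cinner v ((\<chi> b c. G b c) *v v) + cinner v ((\<chi> b c. H b c) *v v)" for v
    by (simp add: cinner_def matrix_vector_mult_def distrib_left distrib_right sum.distrib)
  then show ?case using add.IH by (simp add: positive_op_def)
qed

subsection \<open>Product kernels\<close>

lemma sum_fun_prod:
  fixes g :: "'i::finite \<Rightarrow> 'a::finite \<Rightarrow> 'c::comm_semiring_1"
  shows "(\<Sum>f\<in>UNIV. \<Prod>i\<in>UNIV. g i (f i)) = (\<Prod>i\<in>UNIV. \<Sum>a\<in>UNIV. g i a)"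
  using prod_sum_PiE[of "UNIV :: 'i set" "\<lambda>_. UNIV" g] by (simp add: PiE_UNIV_domain)

lemma prod_mult_prod_Compl:
  fixes f g :: "'s::finite \<Rightarrow> 'a::comm_monoid_mult"
  shows "(\<Prod>i\<in>T. f i) * (\<Prod>i\<in>UNIV - T. g i) = (\<Prod>i\<in>UNIV. if i \<in> T then f i else g i)"
  by (simp add: prod.If_cases Compl_eq_Diff_UNIV)

text \<open>Group the families \<open>D\<close> by their set \<open>T\<close> of agreements with
  \<open>D'\<close>. For fixed \<open>T\<close> the sum factorizes: \<open>D i\<close> is forced on
  \<open>T\<close> and ranges over all other values off \<open>T\<close>.\<close>

lemma sum_matches:
  fixes A :: "'s::finite \<Rightarrow> 'y::finite \<Rightarrow> 'a::comm_ring_1"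
  shows "(\<Sum>D | t \<le> card {i. D' i = D i}. \<Prod>i\<in>UNIV. A i (D i))
           = threshold UNIV (\<lambda>i. \<Sum>y\<in>UNIV. A i y) (\<lambda>i. A i (D' i)) t"
proof -
  have "(\<Sum>D | t \<le> card {i. D' i = D i}. \<Prod>i\<in>UNIV. A i (D i))
      = (\<Sum>T | T \<subseteq> UNIV \<and> t \<le> card T.
           \<Sum>D | D \<in> {D. t \<le> card {i. D' i = D i}} \<and> {i. D' i = D i} = T. \<Prod>i\<in>UNIV. A i (D i))"
    by (rule sum.group[symmetric]) auto
  also have "\<dots> = threshold UNIV (\<lambda>i. \<Sum>y\<in>UNIV. A i y) (\<lambda>i. A i (D' i)) t"
    unfolding threshold_def
  proof (rule sum.cong)
    fix T :: "'s set" assume "T \<in> {T. T \<subseteq> UNIV \<and> t \<le> card T}"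
    then have T: "t \<le> card T" by simp
    have "D i \<in> (if i \<in> T then {D' i} else - {D' i}) \<longleftrightarrow> (D' i = D i \<longleftrightarrow> i \<in> T)" for D i
      by auto
    then have iff: "D \<in> PiE UNIV (\<lambda>i. if i \<in> T then {D' i} else - {D' i}) \<longleftrightarrow> {i. D' i = D i} = T" for D
      unfolding PiE_UNIV_domain Pi_iff by (simp add: set_eq_iff)
    have eq: "{D. D \<in> {D. t \<le> card {i. D' i = D i}} \<and> {i. D' i = D i} = T}
        = PiE UNIV (\<lambda>i. if i \<in> T then {D' i} else - {D' i})"
      by (rule set_eqI, unfold iff mem_Collect_eq) (use T in auto)
    show "(\<Sum>D | D \<in> {D. t \<le> card {i. D' i = D i}} \<and> {i. D' i = D i} = T. \<Prod>i\<in>UNIV. A i (D i))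
        = (\<Prod>i\<in>T. A i (D' i)) * (\<Prod>i\<in>UNIV - T. (\<Sum>y\<in>UNIV. A i y) - A i (D' i))"
      unfolding eq prod_mult_prod_Compl
      by (subst prod_sum_PiE[symmetric])
        (auto intro!: prod.cong simp: Compl_eq_Diff_UNIV sum_diff1)
  qed simp
  finally show ?thesis .
qed

text \<open>Used with diagonal entries for \<open>r\<close> and \<open>k\<close>: the trace of a
  threshold operator is the threshold sum of the traces, since traces of tensor products
  multiply.\<close>

lemma sum_threshold:
  fixes r k :: "'s::finite \<Rightarrow> 'a::finite \<Rightarrow> 'c::comm_ring_1"
  shows "(\<Sum>b\<in>UNIV. threshold UNIV (\<lambda>i. r i (b i)) (\<lambda>i. k i (b i)) t)
           = threshold UNIV (\<lambda>i. \<Sum>a\<in>UNIV. r i a) (\<lambda>i. \<Sum>a\<in>UNIV. k i a) t"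
proof -
  have "(\<Sum>b\<in>UNIV. (\<Prod>i\<in>T. k i (b i)) * (\<Prod>i\<in>UNIV - T. r i (b i) - k i (b i)))
      = (\<Prod>i\<in>T. \<Sum>a\<in>UNIV. k i a) * (\<Prod>i\<in>UNIV - T. (\<Sum>a\<in>UNIV. r i a) - (\<Sum>a\<in>UNIV. k i a))" for T
    unfolding prod_mult_prod_Compl
    by (subst sum_fun_prod[of "\<lambda>i a. if i \<in> T then k i a else r i a - k i a"])
      (auto intro!: prod.cong simp: sum_subtractf)
  then show ?thesis
    unfolding threshold_def by (subst sum.swap) simp
qed

lemma threshold_apply:
  "threshold S R X t b c = threshold S (\<lambda>i. R i b c) (\<lambda>i. X i b c) t"
  by (simp add: threshold_def sum_fun_apply prod_fun_apply)

lemma threshold_of_real: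
  "threshold S (\<lambda>i. of_real (R i)) (\<lambda>i. of_real (X i)) t
     = (of_real (threshold S R X t) :: 'a::{real_algebra_1,comm_ring_1})"
  by (simp add: threshold_def)

text \<open>The kernel of |z><z| tensor \<open>G\<close>: a known challenge \<open>z\<close> next to
  a response state.\<close>

definition slot :: "'c \<Rightarrow> ('d \<Rightarrow> 'd \<Rightarrow> complex) \<Rightarrow> 'c \<times> 'd \<Rightarrow> 'c \<times> 'd \<Rightarrow> complex" where
  "slot z G b c = of_bool (fst b = z) * of_bool (fst c = z) * G (snd b) (snd c)"

lemma gram_slot:
  assumes "gram G"
  shows "gram (slot z G)"
proof -
  have "slot z G = (\<lambda>b c. of_bool (fst b = z) * cnj (of_bool (fst c = z))) * (\<lambda>b c. G (snd b) (snd c))"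
    by (auto simp: slot_def fun_eq_iff)
  then show ?thesis
    using gram_mult[OF gram.rank_one gram_pullback[OF assms]] by simp
qed

lemma slot_diff: "slot z G - slot z H = slot z (G - H)"
  by (auto simp: slot_def fun_eq_iff)

lemma slot_sum: "(\<Sum>i\<in>S. slot z (G i)) = slot z (\<Sum>i\<in>S. G i)"
  by (auto simp: slot_def fun_eq_iff sum_fun_apply sum_distrib_left)

lemma trace_slot:
  fixes G :: "'d::finite \<Rightarrow> 'd \<Rightarrow> complex" and z :: "'c::finite"
  shows "(\<Sum>b\<in>UNIV. slot z G b b) = (\<Sum>d\<in>UNIV. G d d)"
proof -
  have "(\<Sum>b\<in>UNIV. slot z G b b) = (\<Sum>c\<in>UNIV. \<Sum>d\<in>UNIV. if c = z then G d d else 0)"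
    unfolding slot_def UNIV_Times_UNIV[symmetric] sum.cartesian_product
    by (intro sum.cong) auto
  also have "\<dots> = (\<Sum>c\<in>UNIV. if c = z then \<Sum>d\<in>UNIV. G d d else 0)"
    by (intro sum.cong) auto
  finally show ?thesis by simp
qed

definition prod_kernel :: "('m::finite \<Rightarrow> 'a \<Rightarrow> 'a \<Rightarrow> complex) \<Rightarrow> ('m \<Rightarrow> 'a) \<Rightarrow> ('m \<Rightarrow> 'a) \<Rightarrow> complex" where
  "prod_kernel G b c = (\<Prod>j\<in>UNIV. G j (b j) (c j))"

text \<open>Turns a tensor product into a ring product of pulled-back kernels, to which the cone
  lemmas apply.\<close>

lemma prod_kernel_altdef: "prod_kernel G = (\<Prod>j\<in>UNIV. (\<lambda>b c. G j (b j) (c j)))"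
  by (auto simp: prod_kernel_def fun_eq_iff prod_fun_apply)

lemma gram_prod_kernel: "(\<And>j. gram (G j)) \<Longrightarrow> gram (prod_kernel G)"
  unfolding prod_kernel_altdef by (rule gram_cone.prod, rule gram_pullback)

lemma gram_prod_kernel_mono:
  assumes "\<And>j. gram (G j)" "\<And>j. gram (H j - G j)"
  shows "gram (prod_kernel H - prod_kernel G)"
  unfolding prod_kernel_altdef
proof (rule gram_cone.prod_mono)
  fix j
  show "gram ((\<lambda>b c. H j (b j) (c j)) - (\<lambda>b c. G j (b j) (c j)))"
    using gram_pullback[OF assms(2), of j "\<lambda>b. b j"] by (simp add: fun_diff_def)
  show "gram (\<lambda>b c. G j (b j) (c j))"
    using assms(1) by (rule gram_pullback)
qed

lemma sum_prod_kernel: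
  fixes G :: "'m::finite \<Rightarrow> 'y::finite \<Rightarrow> 'a \<Rightarrow> 'a \<Rightarrow> complex"
  shows "(\<Sum>y\<in>UNIV. prod_kernel (\<lambda>j. G j (y j))) = prod_kernel (\<lambda>j. \<Sum>y\<in>UNIV. G j y)"
proof (intro ext)
  fix b c
  show "(\<Sum>y\<in>UNIV. prod_kernel (\<lambda>j. G j (y j))) b c = prod_kernel (\<lambda>j. \<Sum>y\<in>UNIV. G j y) b c"
    using sum_fun_prod[of "\<lambda>j y. G j y (b j) (c j)"] by (simp add: prod_kernel_def sum_fun_apply)
qed

lemma trace_prod_kernel:
  fixes G :: "'m::finite \<Rightarrow> 'a::finite \<Rightarrow> 'a \<Rightarrow> complex"
  shows "(\<Sum>b\<in>UNIV. prod_kernel G b b) = (\<Prod>j\<in>UNIV. \<Sum>a\<in>UNIV. G j a a)"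
  using sum_fun_prod[of "\<lambda>j a. G j a a"] by (simp add: prod_kernel_def)

lemma state_kernel_Tensor:
  "state_kernel (\<Prod>k\<in>UNIV. w k) (Tensor u) = prod_kernel (\<lambda>k. state_kernel (w k) (u k))"
  by (auto simp: state_kernel_def Tensor_def prod_kernel_def fun_eq_iff prod.distrib)

lemma state_kernel_tensor_basis:
  "state_kernel w (tensor (basis_ket z) \<psi>) = slot z (state_kernel w \<psi>)"
  by (auto simp: state_kernel_def tensor_def slot_def axis_def fun_eq_iff)


subsection \<open>Extraction from independent registers\<close>

text \<open>Since the upper bound \<open>K i\<close> on the states is itself below their average, even joint measurements
  do no better than independent guesses that succeed with probability \<open>tr (K i)\<close>.\<close>

lemma extraction_bound:
  fixes A :: "'q::finite \<Rightarrow> 'y::finite \<Rightarrow> 'b::finite \<Rightarrow> 'b \<Rightarrow> complex"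
    and M :: "('q \<Rightarrow> 'y) \<Rightarrow> ('q \<Rightarrow> 'b) operator"
  assumes "povm M"
    and "\<And>i y. gram (A i y)" "\<And>i y. gram (K i - A i y)" "\<And>i. gram ((\<Sum>y\<in>UNIV. A i y) - K i)"
    and "\<And>i. (\<Sum>b\<in>UNIV. K i b b) = complex_of_real P"
    and "\<And>i. (\<Sum>b\<in>UNIV. (\<Sum>y\<in>UNIV. A i y) b b) = 1"
  shows "(\<Sum>D\<in>UNIV. \<Sum>D' | t \<le> card {i. D' i = D i}. pairing (M D') (prod_kernel (\<lambda>i. A i (D i))))
           \<le> threshold (UNIV :: 'q set) (\<lambda>_. 1) (\<lambda>_. P) t"
proof -
  \<comment> \<open>The ring unit is the all-ones kernel, so a single lift is not \<open>G\<close>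
    tensor identity; only products over all \<open>i\<close> are tensor products.\<close>
  let ?lift = "\<lambda>i G b c. G (b i) (c i) :: complex"
  let ?R = "\<lambda>i. \<Sum>y\<in>UNIV. ?lift i (A i y)"
  let ?L = "threshold UNIV ?R (\<lambda>i. ?lift i (K i)) t"
  have R: "?R i = ?lift i (\<Sum>y\<in>UNIV. A i y)" for i
    by (auto simp: fun_eq_iff sum_fun_apply)
  have lift_diff: "gram (?lift i G - ?lift i H)" if "gram (G - H)" for i G H
    using gram_pullback[OF that, of "\<lambda>b. b i"] by (simp add: fun_diff_def)
  have "(\<Sum>D\<in>UNIV. \<Sum>D' | t \<le> card {i. D' i = D i}. pairing (M D') (prod_kernel (\<lambda>i. A i (D i))))
      = (\<Sum>D'\<in>UNIV. \<Sum>D | t \<le> card {i. D' i = D i}. pairing (M D') (prod_kernel (\<lambda>i. A i (D i))))"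
    using sum.swap_restrict[of UNIV UNIV "\<lambda>D D'. pairing (M D') (prod_kernel (\<lambda>i. A i (D i)))"
        "\<lambda>D D'. t \<le> card {i. D' i = D i}"] by simp
  also have "\<dots> = (\<Sum>D'\<in>UNIV. pairing (M D') (threshold UNIV ?R (\<lambda>i. ?lift i (A i (D' i))) t))"
    unfolding pairing_sum[symmetric] prod_kernel_altdef
    by (subst sum_matches[where A = "\<lambda>i y. ?lift i (A i y)"]) (rule refl)
  \<comment> \<open>\<open>?L\<close> does not depend on the guess \<open>D'\<close>, so it is a
    feasible dual operator for the joint measurement.\<close>
  also have "\<dots> \<le> Re (\<Sum>b\<in>UNIV. ?L b b)"
  proof (rule povm_pairing_le_trace[OF assms(1)], rule gram_cone.threshold_mono)
    fix i
    show "gram (?R i - ?lift i (K i))"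
      unfolding R by (rule lift_diff[OF assms(4)])
    show "gram (?lift i (K i) - ?lift i (A i (D' i)))" for D'
      by (rule lift_diff[OF assms(3)])
    show "gram (?lift i (A i (D' i)))" for D'
      using assms(2) by (rule gram_pullback)
  qed simp
  also have "(\<Sum>b\<in>UNIV. ?L b b) = threshold UNIV (\<lambda>i. \<Sum>b\<in>UNIV. (\<Sum>y\<in>UNIV. A i y) b b)
      (\<lambda>i. \<Sum>b\<in>UNIV. K i b b) t"
    unfolding R threshold_apply by (rule sum_threshold)
  also have "\<dots> = complex_of_real (threshold (UNIV :: 'q set) (\<lambda>_. 1) (\<lambda>_. P) t)"
    using assms(5,6) threshold_of_real[of "UNIV :: 'q set" "\<lambda>_. 1" "\<lambda>_. P" t, where 'a = complex] by simp
  finally show ?thesis by simp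
qed


subsection \<open>A single qubit\<close>

definition bit_weight :: "real \<Rightarrow> bool \<times> bool \<Rightarrow> real" where
  "bit_weight p y = (if fst y then 1 - p else p) * (if snd y then 1 - p else p)"

definition qubit_kernel :: "real \<Rightarrow> bool \<times> bool \<Rightarrow> bool \<Rightarrow> bool \<Rightarrow> complex" where
  "qubit_kernel p y = state_kernel (bit_weight p y) (encode y)"

lemma bit_weight_nonneg: "0 \<le> p \<Longrightarrow> p \<le> 1 \<Longrightarrow> 0 \<le> bit_weight p y"
  by (simp add: bit_weight_def)

lemma gram_qubit_kernel: "0 \<le> p \<Longrightarrow> p \<le> 1 \<Longrightarrow> gram (qubit_kernel p y)"
  unfolding qubit_kernel_def by (intro gram_state_kernel bit_weight_nonneg)

lemma qubit_kernel_simps: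
  "qubit_kernel p (False, False) = bool_kernel (p\<^sup>2) 0 0"
  "qubit_kernel p (True, False) = bool_kernel 0 (p * (1 - p)) 0"
  "qubit_kernel p (False, True) = bool_kernel (p * (1 - p) / 2) (p * (1 - p) / 2) (p * (1 - p) / 2)"
  "qubit_kernel p (True, True) = bool_kernel ((1 - p)\<^sup>2 / 2) ((1 - p)\<^sup>2 / 2) (- ((1 - p)\<^sup>2 / 2))"
proof -
  have s: "complex_of_real (sqrt 2) * complex_of_real (sqrt 2) = 2"
    by (simp flip: of_real_mult)
  show "qubit_kernel p (False, False) = bool_kernel (p\<^sup>2) 0 0"
    "qubit_kernel p (True, False) = bool_kernel 0 (p * (1 - p)) 0"
    "qubit_kernel p (False, True) = bool_kernel (p * (1 - p) / 2) (p * (1 - p) / 2) (p * (1 - p) / 2)"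
    "qubit_kernel p (True, True) = bool_kernel ((1 - p)\<^sup>2 / 2) ((1 - p)\<^sup>2 / 2) (- ((1 - p)\<^sup>2 / 2))"
    by (auto simp: qubit_kernel_def state_kernel_def bit_weight_def bool_kernel_def axis_def
        ket_plus_def ket_minus_def fun_eq_iff power2_eq_square s mult_ac)
      (auto simp: algebra_simps)
qed

lemma UNIV_bit_pair: "(UNIV :: (bool \<times> bool) set) = {(False, False), (True, False), (False, True), (True, True)}"
  by auto

lemma sum_qubit_kernel:
  "(\<Sum>y\<in>UNIV. qubit_kernel p y)
     = bool_kernel (p\<^sup>2 + p * (1 - p) / 2 + (1 - p)\<^sup>2 / 2)
         (p * (1 - p) + p * (1 - p) / 2 + (1 - p)\<^sup>2 / 2)
         (p * (1 - p) / 2 - (1 - p)\<^sup>2 / 2)"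
  by (simp add: UNIV_bit_pair qubit_kernel_simps bool_kernel_add algebra_simps)

lemma trace_bool_kernel: "(\<Sum>b\<in>UNIV. bool_kernel x y z b b) = complex_of_real (x + y)"
  by (simp add: UNIV_bool bool_kernel_def)

text \<open>The measurement in the computational basis, with outcomes read as basis bit \<open>0\<close>, is an
  optimal guess of both bits; \<open>K\<close> is the corresponding dual solution.\<close>

lemma
  fixes p :: real
  defines "K \<equiv> bool_kernel (p\<^sup>2) (p * (1 - p)) 0"
  assumes p: "1 / 2 \<le> p" "p \<le> 1"
  shows gram_qubit_dual_diff: "gram (K - qubit_kernel p y)"
    and gram_qubit_average_diff: "gram ((\<Sum>y\<in>UNIV. qubit_kernel p y) - K)"
proof -
  have e: "0 \<le> 1 - p" "1 - p \<le> p" using p by auto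
  have sq: "(1 - p)\<^sup>2 \<le> p * (1 - p)" "p * (1 - p) \<le> p\<^sup>2"
    using e p by (auto simp: power2_eq_square intro: mult_right_mono mult_left_mono)
  have nn: "0 \<le> p * (1 - p)" using e p by simp
  consider "y = (False, False)" | "y = (True, False)" | "y = (False, True)" | "y = (True, True)"
    using UNIV_bit_pair by blast
  then show "gram (K - qubit_kernel p y)"
  proof cases
    case 3
    \<comment> \<open>The determinant condition; it comes down to
      \<open>p * (1 - p) \<le> p\<^sup>2\<close>, which is where \<open>p \<ge> 1/2\<close>
      enters.\<close>
    have "(p * (1 - p) / 2) * (p * (1 - p) / 2) \<le> (p\<^sup>2 - p * (1 - p) / 2) * (p * (1 - p) / 2)"
      using sq nn by (intro mult_right_mono) auto
    then show ?thesis
      unfolding K_def 3 qubit_kernel_simps bool_kernel_diff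
      using sq nn by (intro gram_bool_kernel) (auto simp: power2_eq_square)
  next
    case 4
    have "((1 - p)\<^sup>2 / 2) * ((1 - p)\<^sup>2 / 2) \<le> (p\<^sup>2 - (1 - p)\<^sup>2 / 2) * (p * (1 - p) - (1 - p)\<^sup>2 / 2)"
      using sq nn by (intro mult_mono) auto
    then show ?thesis
      unfolding K_def 4 qubit_kernel_simps bool_kernel_diff
      using sq nn by (intro gram_bool_kernel) (auto simp: power2_eq_square[of "_ / 2"])
  qed (use nn in \<open>auto simp: K_def qubit_kernel_simps bool_kernel_diff intro!: gram_bool_kernel\<close>)
  \<comment> \<open>\<open>K\<close> is exactly the sum of the two computational-basis states, so
    the two diagonal-basis states remain.\<close>
  have "(\<Sum>y\<in>UNIV. qubit_kernel p y) - K = qubit_kernel p (False, True) + qubit_kernel p (True, True)"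
    unfolding K_def qubit_kernel_simps sum_qubit_kernel bool_kernel_diff bool_kernel_add
    by (simp add: algebra_simps)
  then show "gram ((\<Sum>y\<in>UNIV. qubit_kernel p y) - K)"
    using p by (auto intro!: gram_cone.add gram_qubit_kernel)
qed

subsection \<open>The law of the responses\<close>

lemma pmf_bit_pair:
  assumes "0 \<le> p" "p \<le> 1"
  shows "pmf (pair_pmf (puf_bit p) (puf_bit p)) y = bit_weight p y"
  using assms by (cases y) (auto simp: pmf_pair puf_bit_def bit_weight_def)

lemma expectation_finite:
  fixes f :: "'a::finite \<Rightarrow> real"
  shows "measure_pmf.expectation Q f = (\<Sum>a\<in>UNIV. pmf Q a * f a)"
  by (subst integral_measure_pmf_real[of UNIV]) (auto simp: mult.commute)

text \<open>Distinct challenges read distinct entries of the random table: restrict the table to the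
  range of \<open>x\<close>, then reindex along \<open>x\<close>.\<close>

lemma expectation_responses:
  fixes x :: "'q::finite \<Rightarrow> 'n::finite challenge" and g :: "('q \<Rightarrow> 'm::finite response) \<Rightarrow> real"
  assumes "0 \<le> p" "p \<le> 1" "inj x"
  shows "measure_pmf.expectation (classical_puf p) (\<lambda>f. g (\<lambda>i. f (x i)))
           = (\<Sum>D\<in>UNIV. (\<Prod>i\<in>UNIV. \<Prod>j\<in>UNIV. bit_weight p (D i j)) * g D)"
proof -
  let ?Q = "Pi_pmf UNIV undefined (\<lambda>j. pair_pmf (puf_bit p) (puf_bit p)) :: 'm response pmf"
  have "map_pmf (\<lambda>f i. f (x i)) (classical_puf p :: ('n challenge \<Rightarrow> 'm response) pmf)
      = map_pmf (\<lambda>g. g \<circ> x)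
          (map_pmf (\<lambda>f c. if c \<in> range x then f c else undefined) (Pi_pmf UNIV undefined (\<lambda>_. ?Q)))"
    by (simp add: classical_puf_def pmf.map_comp comp_def)
  also have "\<dots> = map_pmf (\<lambda>g. g \<circ> x) (Pi_pmf (range x) undefined (\<lambda>_. ?Q))"
    by (subst Pi_pmf_subset[of UNIV "range x"]) auto
  also have "\<dots> = Pi_pmf UNIV undefined (\<lambda>_. ?Q)"
    using assms(3) by (intro Pi_pmf_bij_betw[symmetric]) (auto simp: bij_betw_def)
  finally have law: "map_pmf (\<lambda>f i. f (x i)) (classical_puf p) = Pi_pmf UNIV undefined (\<lambda>_ :: 'q. ?Q)" .
  have "measure_pmf.expectation (classical_puf p) (\<lambda>f. g (\<lambda>i. f (x i)))
      = measure_pmf.expectation (map_pmf (\<lambda>f i. f (x i)) (classical_puf p)) g"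
    by (simp add: integral_map_pmf)
  then show ?thesis
    unfolding law using assms(1,2) by (simp add: expectation_finite pmf_Pi pmf_bit_pair)
qed

lemma expectation_response_pair:
  fixes x :: "'n::finite challenge" and j :: "'m::finite"
  assumes "0 \<le> p" "p \<le> 1"
  shows "measure_pmf.expectation (classical_puf p) (\<lambda>f. g (f x j))
           = (\<Sum>y\<in>UNIV. bit_weight p y * g y)"
proof -
  let ?B = "pair_pmf (puf_bit p) (puf_bit p)"
  have "map_pmf (\<lambda>f. f x j) (classical_puf p :: ('n challenge \<Rightarrow> 'm response) pmf)
      = map_pmf (\<lambda>y. y j) (map_pmf (\<lambda>f. f x) (classical_puf p))"
    by (simp add: pmf.map_comp comp_def)
  also have "\<dots> = ?B"
    unfolding classical_puf_def by (simp add: Pi_pmf_component)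
  finally have law: "map_pmf (\<lambda>f. f x j) (classical_puf p :: ('n challenge \<Rightarrow> 'm response) pmf) = ?B" .
  have "measure_pmf.expectation (classical_puf p) (\<lambda>f. g (f x j))
      = measure_pmf.expectation (map_pmf (\<lambda>f. f x j) (classical_puf p :: ('n challenge \<Rightarrow> 'm response) pmf)) g"
    by (simp add: integral_map_pmf)
  then show ?thesis
    unfolding law using assms by (simp add: expectation_finite pmf_bit_pair)
qed

section \<open>Extraction from the hybrid PUF, averaged over the challenges\<close>

lemma expectation_pair_le:
  fixes F :: "'a::finite \<times> 'b::finite \<Rightarrow> real"
  assumes "\<And>a. a \<in> set_pmf A \<Longrightarrow> measure_pmf.expectation B (\<lambda>b. F (a, b)) \<le> C"
  shows "measure_pmf.expectation (pair_pmf A B) F \<le> C"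
proof -
  have "measure_pmf.expectation (pair_pmf A B) F
      = (\<Sum>(a, b)\<in>UNIV. pmf A a * (pmf B b * F (a, b)))"
    by (auto simp: expectation_finite pmf_pair intro!: sum.cong)
  also have "\<dots> = (\<Sum>a\<in>UNIV. pmf A a * measure_pmf.expectation B (\<lambda>b. F (a, b)))"
    unfolding UNIV_Times_UNIV[symmetric] sum.cartesian_product[symmetric]
    by (simp add: expectation_finite sum_distrib_left)
  also have "\<dots> \<le> (\<Sum>a\<in>UNIV. pmf A a * C)"
  proof (intro sum_mono)
    fix a
    show "pmf A a * measure_pmf.expectation B (\<lambda>b. F (a, b)) \<le> pmf A a * C"
      using assms by (cases "a \<in> set_pmf A") (auto simp: set_pmf_iff intro: mult_left_mono)
  qed
  also have "\<dots> = C"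
    by (simp add: sum_distrib_right[symmetric] sum_pmf_eq_1)
  finally show ?thesis .
qed

text \<open>Ensures that the uniform distribution in \<open>challenges\<close> is over a nonempty
  set, so that its support consists of injective families.\<close>

lemma exists_inj_challenges:
  assumes "CARD('q::finite) \<le> 2 ^ CARD('n::finite)"
  shows "{x :: 'q \<Rightarrow> 'n challenge. inj x} \<noteq> {}"
proof -
  have "CARD('n challenge) = 2 ^ CARD('n)"
    by (simp add: card_fun)
  then show ?thesis
    using assms card_le_inj[of "UNIV :: 'q set" "UNIV :: 'n challenge set"] by auto
qed

lemma db_dist_le_iff:
  fixes D D' :: "'q::finite \<Rightarrow> 'm response"
  shows "db_dist D' D \<le> \<epsilon> \<longleftrightarrow> nat \<lceil>(1 - \<epsilon>) * real CARD('q)\<rceil> \<le> card {i. D' i = D i}"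
proof -
  have "{i. D' i \<noteq> D i} = UNIV - {i. D' i = D i}" by auto
  then have "card {i. D' i \<noteq> D i} = CARD('q) - card {i. D' i = D i}"
    by (simp add: card_Diff_subset)
  moreover have "card {i. D' i = D i} \<le> CARD('q)" by (intro card_mono) auto
  ultimately have "db_dist D' D = (real CARD('q) - card {i. D' i = D i}) / CARD('q)"
    by (simp add: db_dist_def of_nat_diff)
  then have "db_dist D' D \<le> \<epsilon> \<longleftrightarrow> (1 - \<epsilon>) * real CARD('q) \<le> card {i. D' i = D i}"
    by (simp only:) (simp add: field_simps)
  then show ?thesis by (simp add: nat_le_iff ceiling_le_iff)
qed

lemma p_extract_le_threshold:
  fixes M :: "('q::finite \<Rightarrow> 'm::finite response)
               \<Rightarrow> ('q \<Rightarrow> 'n::finite challenge \<times> ('m \<Rightarrow> bool)) operator"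
  assumes p: "1 / 2 \<le> p" "p \<le> 1" and "CARD('q) \<le> 2 ^ CARD('n)" and M: "povm M"
  shows "p_extract p \<epsilon> M
           \<le> threshold (UNIV :: 'q set) (\<lambda>_. 1) (\<lambda>_. p ^ CARD('m)) (nat \<lceil>(1 - \<epsilon>) * real CARD('q)\<rceil>)"
    (is "_ \<le> threshold _ _ _ ?t")
  unfolding p_extract_def
proof (rule expectation_pair_le)
  fix x :: "'q \<Rightarrow> 'n challenge" assume "x \<in> set_pmf challenges"
  then have inj: "inj x"
    using exists_inj_challenges[OF assms(3)] by (auto simp: challenges_def set_pmf_of_set)
  have p0: "0 \<le> p" using p by simp
  let ?K = "bool_kernel (p\<^sup>2) (p * (1 - p)) 0"
  let ?A = "\<lambda>i (y :: 'm response). slot (x i) (prod_kernel (\<lambda>j. qubit_kernel p (y j)))"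
  let ?w = "\<lambda>D :: 'q \<Rightarrow> 'm response. \<Prod>i\<in>UNIV. \<Prod>j\<in>UNIV. bit_weight p (D i j)"
  let ?\<psi> = "\<lambda>D. Tensor (\<lambda>i. tensor (basis_ket (x i)) (hybrid_state (D i)))"
  have \<psi>: "?w D * born (M D') (?\<psi> D) = pairing (M D') (prod_kernel (\<lambda>i. ?A i (D i)))" for D D'
    unfolding pairing_state_kernel[symmetric] hybrid_state_def state_kernel_Tensor
      state_kernel_tensor_basis qubit_kernel_def ..
  have sum_A: "(\<Sum>y\<in>UNIV. ?A i y) = slot (x i) (prod_kernel (\<lambda>_. \<Sum>y\<in>UNIV. qubit_kernel p y))" for i
    using sum_prod_kernel[of "\<lambda>_ :: 'm. qubit_kernel p"] by (simp add: slot_sum)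
  have "measure_pmf.expectation (classical_puf p)
        (\<lambda>f. \<Sum>D' | db_dist D' (\<lambda>i. f (x i)) \<le> \<epsilon>. born (M D') (database x f))
      = (\<Sum>D\<in>UNIV. ?w D * (\<Sum>D' | db_dist D' D \<le> \<epsilon>. born (M D') (?\<psi> D)))"
    unfolding database_def
    using expectation_responses[OF p0 p(2) inj, of "\<lambda>D. \<Sum>D' | db_dist D' D \<le> \<epsilon>. born (M D') (?\<psi> D)"]
    by simp
  also have "\<dots> = (\<Sum>D\<in>UNIV. \<Sum>D' | ?t \<le> card {i. D' i = D i}. pairing (M D') (prod_kernel (\<lambda>i. ?A i (D i))))"
    unfolding sum_distrib_left \<psi> db_dist_le_iff ..
  also have "\<dots> \<le> threshold (UNIV :: 'q set) (\<lambda>_. 1) (\<lambda>_. p ^ CARD('m)) ?t"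
  proof (rule extraction_bound[OF M, where A = ?A and K = "\<lambda>i. slot (x i) (prod_kernel (\<lambda>_. ?K))"])
    fix i y
    show "gram (?A i y)"
      using p by (intro gram_slot gram_prod_kernel gram_qubit_kernel) auto
    show "gram (slot (x i) (prod_kernel (\<lambda>_. ?K)) - ?A i y)"
      unfolding slot_diff using p
      by (intro gram_slot gram_prod_kernel_mono gram_qubit_dual_diff gram_qubit_kernel) auto
    show "gram ((\<Sum>y\<in>UNIV. ?A i y) - slot (x i) (prod_kernel (\<lambda>_. ?K)))"
      unfolding sum_A slot_diff using p
      by (intro gram_slot gram_prod_kernel_mono gram_qubit_average_diff gram_bool_kernel) auto
    \<comment> \<open>The one-qubit dual operator has trace \<open>p\<close>, hence \<open>m\<close>
      qubits give success parameter \<open>p ^ m\<close>.\<close>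
    have "p\<^sup>2 + p * (1 - p) = p" by (simp add: power2_eq_square algebra_simps)
    then show "(\<Sum>b\<in>UNIV. slot (x i) (prod_kernel (\<lambda>_ :: 'm. ?K)) b b) = complex_of_real (p ^ CARD('m))"
      by (simp only: trace_slot trace_prod_kernel trace_bool_kernel) simp
    have "p\<^sup>2 + p * (1 - p) / 2 + (1 - p)\<^sup>2 / 2 + (p * (1 - p) + p * (1 - p) / 2 + (1 - p)\<^sup>2 / 2) = 1"
      by (simp add: power2_eq_square field_simps)
    then show "(\<Sum>b\<in>UNIV. (\<Sum>y\<in>UNIV. ?A i y) b b) = 1"
      by (simp only: sum_A trace_slot trace_prod_kernel sum_qubit_kernel trace_bool_kernel) simp
  qed
  finally show "measure_pmf.expectation (classical_puf p)
      (\<lambda>f. case (x, f) of (x, f) \<Rightarrow>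
         \<Sum>D' | db_dist D' (\<lambda>i. f (x i)) \<le> \<epsilon>. born (M D') (database x f))
      \<le> threshold (UNIV :: 'q set) (\<lambda>_. 1) (\<lambda>_. p ^ CARD('m)) ?t"
    by simp
qed


subsection \<open>The optimal guess of a value bit\<close>

text \<open>The measurement is the identity on the challenge tensor \<open>N\<close>; the challenge
  state \<open>z\<close> selects a single block.\<close>

lemma pairing_slot:
  fixes z :: "'c::finite"
  shows "pairing (\<chi> b c. of_bool (fst b = fst c) * N (snd b) (snd c)) (slot z G)
           = Re (\<Sum>b\<in>UNIV. \<Sum>c\<in>UNIV. N b c * G c b)"
proof -
  have pair: "(\<Sum>b\<in>UNIV. f b) = (\<Sum>b1\<in>UNIV. \<Sum>b2\<in>UNIV. f (b1, b2))" for f :: "'c \<times> 'd::finite \<Rightarrow> complex"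
    by (simp add: sum.cartesian_product flip: UNIV_Times_UNIV)
  have "(\<Sum>b\<in>UNIV. \<Sum>c\<in>UNIV. of_bool (fst b = fst c) * N (snd b) (snd c) * slot z G c b)
     = (\<Sum>b1\<in>UNIV. \<Sum>b2\<in>UNIV. \<Sum>c1\<in>UNIV.
          if c1 = z then \<Sum>c2\<in>UNIV. if b1 = z then N b2 c2 * G c2 b2 else 0 else 0)"
    unfolding pair slot_def by (intro sum.cong) auto
  also have "\<dots> = (\<Sum>b1\<in>UNIV. if b1 = z then \<Sum>b2\<in>UNIV. \<Sum>c2\<in>UNIV. N b2 c2 * G c2 b2 else 0)"
    by (intro sum.cong) auto
  also have "\<dots> = (\<Sum>b\<in>UNIV. \<Sum>c\<in>UNIV. N b c * G c b)"
    by simp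
  finally show ?thesis by (simp add: pairing_def)
qed

lemma pairing_slot_bool_kernel:
  fixes z :: "'c::finite"
  shows "pairing (\<chi> b c. of_bool (fst b = fst c) * bool_kernel x y w (snd b) (snd c))
           (slot z (bool_kernel x' y' w')) = x * x' + y * y' + 2 * w * w'"
  unfolding pairing_slot by (simp add: bool_kernel_def UNIV_bool)

lemma povm_slot:
  fixes N :: "bool \<Rightarrow> 'd::finite \<Rightarrow> 'd \<Rightarrow> complex"
  assumes "\<And>v. gram (N v)" "\<And>b c. N False b c + N True b c = of_bool (b = c)"
  shows "povm (\<lambda>v. \<chi> b c :: 'c::finite \<times> 'd. of_bool (fst b = fst c) * N v (snd b) (snd c))"
  unfolding povm_def
proof (intro conjI allI)
  fix v
  have "gram (\<Sum>z\<in>(UNIV :: 'c set). (\<lambda>b c. of_bool (b = z) * cnj (of_bool (c = z))))"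
    by (rule gram_cone.sum, rule gram.rank_one)
  moreover have "(\<Sum>z\<in>UNIV. of_bool (b = z) * cnj (of_bool (c = z))) = (\<Sum>z\<in>UNIV. if z = b then of_bool (b = c) else 0 :: complex)"
    for b c :: 'c
    by (intro sum.cong) auto
  ultimately have "gram (\<lambda>b c :: 'c. of_bool (b = c))"
    by (simp add: sum_fun_apply[abs_def])
  from gram_mult[OF gram_pullback[OF this, of fst] gram_pullback[OF assms(1)[of v], of snd]]
  have "gram (\<lambda>b c :: 'c \<times> 'd. of_bool (fst b = fst c) * N v (snd b) (snd c))"
    by (simp add: times_fun_def)
  then show "positive_op (\<chi> b c :: 'c \<times> 'd. of_bool (fst b = fst c) * N v (snd b) (snd c))"
    by (rule positive_op_gram)
next
  show "(\<Sum>v\<in>UNIV. \<chi> b c :: 'c \<times> 'd. of_bool (fst b = fst c) * N v (snd b) (snd c)) = mat 1"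
    using assms(2) by (auto simp: UNIV_bool vec_eq_iff mat_def prod_eq_iff distrib_left[symmetric] add.commute)
qed

text \<open>Below \<open>(u, w)\<close> is the unit vector along \<open>(p, e)\<close>, where \<open>e = 1 - p\<close>, and \<open>r\<close> is the length
  of \<open>(p, e)\<close>.  The left-hand sides are the entries of the dual operator minus a value-bit state,
  the right-hand sides exhibit the difference as a multiple of a projection.\<close>

lemma helstrom_dual_identities:
  fixes p r u w e :: real
  assumes a: "r * u = p" "r * w = e" "p + e = 1"
  shows "(1 + r) / 4 * (1 + (p - e) * u) - (p\<^sup>2 + p * e / 2) = (r - (p - e)) / 4 * (1 - u)"
    "(1 + r) / 4 * (1 - (p - e) * u) - p * e / 2 = (r - (p - e)) / 4 * (1 + u)"
    "(1 + r) / 4 * ((p - e) * w) - p * e / 2 = - ((r - (p - e)) / 4 * w)"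
    "(1 + r) / 4 * (1 + (p - e) * u) - e\<^sup>2 / 2 = (r + (p - e)) / 4 * (1 + u)"
    "(1 + r) / 4 * (1 - (p - e) * u) - (p * e + e\<^sup>2 / 2) = (r + (p - e)) / 4 * (1 - u)"
    "(1 + r) / 4 * ((p - e) * w) - - (e\<^sup>2 / 2) = (r + (p - e)) / 4 * w"
proof -
  have e: "e = 1 - p" using a by simp
  have b: "r * u = p" "p * (r * u) = p * p" "r * w = 1 - p" "p * (r * w) = p * (1 - p)" using a by auto
  note b = b[unfolded right_diff_distrib mult_1_right mult.left_commute[of p r]]
  show "(1 + r) / 4 * (1 + (p - e) * u) - (p\<^sup>2 + p * e / 2) = (r - (p - e)) / 4 * (1 - u)"
    "(1 + r) / 4 * (1 - (p - e) * u) - p * e / 2 = (r - (p - e)) / 4 * (1 + u)"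
    "(1 + r) / 4 * ((p - e) * w) - p * e / 2 = - ((r - (p - e)) / 4 * w)"
    "(1 + r) / 4 * (1 + (p - e) * u) - e\<^sup>2 / 2 = (r + (p - e)) / 4 * (1 + u)"
    "(1 + r) / 4 * (1 - (p - e) * u) - (p * e + e\<^sup>2 / 2) = (r + (p - e)) / 4 * (1 - u)"
    "(1 + r) / 4 * ((p - e) * w) - - (e\<^sup>2 / 2) = (r + (p - e)) / 4 * w"
    unfolding e power2_eq_square using b by (simp_all add: field_simps)
qed

text \<open>The success probability of measuring along \<open>(u, w)\<close>, written with
  \<open>pairing_slot_bool_kernel\<close>. It reduces to \<open>p * u + e * w = r\<close>, the
  length of \<open>(p, e)\<close>.\<close>

lemma helstrom_success_identity:
  fixes p r u w e :: real
  assumes a: "r * u = p" "r * w = e" "p + e = 1" "u\<^sup>2 + w\<^sup>2 = 1"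
  shows "(1 + u) / 2 * (p\<^sup>2 + p * e / 2) + (1 - u) / 2 * (p * e / 2) + 2 * (w / 2) * (p * e / 2)
      + ((1 - u) / 2 * (e\<^sup>2 / 2) + (1 + u) / 2 * (p * e + e\<^sup>2 / 2) + 2 * (- (w / 2)) * (- (e\<^sup>2 / 2)))
      = (1 + r) / 2"
proof -
  have "p * u + e * w = r * (u\<^sup>2 + w\<^sup>2)" unfolding a(1,2)[symmetric] by (simp add: power2_eq_square algebra_simps)
  then have pu: "p * u + e * w = r" using a(4) by simp
  have "(1 + u) / 2 * (p\<^sup>2 + p * e / 2) + (1 - u) / 2 * (p * e / 2) + 2 * (w / 2) * (p * e / 2)
      + ((1 - u) / 2 * (e\<^sup>2 / 2) + (1 + u) / 2 * (p * e + e\<^sup>2 / 2) + 2 * (- (w / 2)) * (- (e\<^sup>2 / 2)))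
    = (p + e) * (p + e + (p * u + e * w)) / 2"
    by (simp add: power2_eq_square field_simps)
  then show ?thesis using a(3) pu by simp
qed

text \<open>The Helstrom bound: the two value-bit states, weighted by their
  probabilities, have coefficients \<open>p/2 (1, p, 1 - p)\<close> and \<open>(1 - p)/2 (1, - p, p - 1)\<close>
  with respect to the Pauli matrices \<open>I, Z, X\<close>, so the optimal
  projective measurement is along \<open>(p, 1 - p)\<close>.\<close>

lemma p_guess_eq:
  fixes x :: "'n::finite challenge" and j :: "'m::finite"
  assumes p: "1 / 2 \<le> p" "p \<le> 1"
  shows "p_guess p x j = (1 + sqrt (p\<^sup>2 + (1 - p)\<^sup>2)) / 2"
proof -
  define e where "e = 1 - p"
  define r where "r = sqrt (p\<^sup>2 + e\<^sup>2)"
  have e: "0 \<le> e" "e \<le> p" and p0: "0 < p" using p by (auto simp: e_def)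
  have r2: "r\<^sup>2 = p\<^sup>2 + e\<^sup>2" by (simp add: r_def)
  have r: "0 < r" "p \<le> r" "e \<le> r" using p0 by (auto simp: r_def intro: real_le_rsqrt add_pos_nonneg)
  have pe: "p = 1 - e" by (simp add: e_def)
  define G where "G v = qubit_kernel p (v, False) + qubit_kernel p (v, True)" for v
  have G: "G False = bool_kernel (p\<^sup>2 + p * e / 2) (p * e / 2) (p * e / 2)"
     "G True = bool_kernel (e\<^sup>2 / 2) (p * e + e\<^sup>2 / 2) (- (e\<^sup>2 / 2))"
    by (auto simp: G_def qubit_kernel_simps bool_kernel_add e_def)
  define val where "val M = measure_pmf.expectation
          (classical_puf p :: ('n challenge \<Rightarrow> 'm response) pmf)
          (\<lambda>f. born (M (fst (f x j))) (tensor (basis_ket x) (encode (f x j))))"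
    for M :: "bool \<Rightarrow> ('n challenge \<times> bool) operator"
  have val: "val M = (\<Sum>v\<in>UNIV. pairing (M v) (slot x (G v)))" for M
  proof -
    have slot_add: "slot x (H + H') = slot x H + slot x H'" for H H' :: "bool \<Rightarrow> bool \<Rightarrow> complex"
      by (auto simp: slot_def fun_eq_iff distrib_left)
    have "val M = (\<Sum>y\<in>UNIV. pairing (M (fst y)) (slot x (qubit_kernel p y)))"
      unfolding val_def qubit_kernel_def state_kernel_tensor_basis[symmetric] pairing_state_kernel
      using p by (intro expectation_response_pair) auto
    then show ?thesis
      by (simp add: UNIV_bit_pair UNIV_bool G_def slot_add pairing_add)
  qed
  have upper: "val M \<le> (1 + r) / 2" if "povm M" for M
  proof -
    \<comment> \<open>Put \<sigma> = (p Z + e X)/r. The weighted value-bit states are p/2 (I + r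
      \<sigma>) and e/2 (I - r \<sigma>), the optimal projectors (I + \<sigma>)/2 and (I -
      \<sigma>)/2. Summing projector times state gives \<open>L\<close>, i.e. (1 + r)/4 (I + (p - e)
      \<sigma>).\<close>
    define L where "L = bool_kernel ((1 + r) / 4 * (1 + (p - e) * (p / r)))
        ((1 + r) / 4 * (1 - (p - e) * (p / r))) ((1 + r) / 4 * ((p - e) * (e / r)))"
    have "gram (L - G v)" for v
    proof -
      have s: "p - e \<le> r" "0 \<le> p - e" using e r by auto
      have unit: "(e / r)\<^sup>2 = (1 - p / r) * (1 + p / r)"
        using r r2 by (simp add: field_simps power2_eq_square)
      have c: "0 \<le> 1 - p / r" "0 \<le> 1 + p / r" using r p0 by auto
      have LG: "L - G v = (if v
          then bool_kernel ((r + (p - e)) / 4 * (1 + p / r)) ((r + (p - e)) / 4 * (1 - p / r)) ((r + (p - e)) / 4 * (e / r))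
          else bool_kernel ((r - (p - e)) / 4 * (1 - p / r)) ((r - (p - e)) / 4 * (1 + p / r)) (- ((r - (p - e)) / 4 * (e / r))))"
      proof -
        have "r * (p / r) = p" "r * (e / r) = e" "p + e = 1"
          using r by (auto simp: pe)
        note helstrom_dual_identities[OF this]
        then show ?thesis
          by (cases v) (simp_all only: G L_def bool_kernel_diff if_True if_False)
      qed
      \<comment> \<open>These are a (I + \<sigma>) and a (I - \<sigma>); by \<open>unit\<close>
        their determinants vanish.\<close>
      have psd: "gram (bool_kernel (a * (1 + p / r)) (a * (1 - p / r)) (a * (e / r)))"
        "gram (bool_kernel (a * (1 - p / r)) (a * (1 + p / r)) (- (a * (e / r))))" if "0 \<le> a" for a
      proof -
        have "(a * (e / r))\<^sup>2 = a * (1 - p / r) * (a * (1 + p / r))"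
          unfolding power_mult_distrib unit by (simp add: power2_eq_square)
        then show "gram (bool_kernel (a * (1 + p / r)) (a * (1 - p / r)) (a * (e / r)))"
          "gram (bool_kernel (a * (1 - p / r)) (a * (1 + p / r)) (- (a * (e / r))))"
          using that c by (auto intro!: gram_bool_kernel simp: mult.commute)
      qed
      show ?thesis
        using psd(1)[of "(r + (p - e)) / 4"] psd(2)[of "(r - (p - e)) / 4"] r s
        unfolding LG by (cases v) (simp_all only: if_True if_False, simp_all)
    qed
    then have "gram (slot x L - slot x (G v))" for v
      unfolding slot_diff by (rule gram_slot)
    then have "val M \<le> Re (\<Sum>b\<in>UNIV. slot x L b b)"
      unfolding val by (rule povm_pairing_le_trace[OF that])
    also have "\<dots> = (1 + r) / 2"
      unfolding trace_slot L_def trace_bool_kernel by (simp add: field_simps)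
    finally show ?thesis .
  qed
  \<comment> \<open>The spectral projectors of \<sigma>; they attain the dual bound.\<close>
  define N where "N v = (if v then bool_kernel ((1 - p / r) / 2) ((1 + p / r) / 2) (- (e / r / 2))
     else bool_kernel ((1 + p / r) / 2) ((1 - p / r) / 2) (e / r / 2))" for v
  define M :: "bool \<Rightarrow> ('n challenge \<times> bool) operator"
    where "M v = (\<chi> b c. of_bool (fst b = fst c) * N v (snd b) (snd c))" for v
  have M: "povm M"
    unfolding M_def
  proof (rule povm_slot)
    have "(e / r / 2)\<^sup>2 = (1 - p / r) / 2 * ((1 + p / r) / 2)"
      using r r2 by (simp add: field_simps power2_eq_square)
    moreover have "0 \<le> 1 - p / r" "0 \<le> 1 + p / r" using r p0 by auto
    ultimately show "gram (N v)" for v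
      unfolding N_def by (auto intro!: gram_bool_kernel simp: mult.commute)
    show "N False b c + N True b c = of_bool (b = c)" for b c
      by (auto simp: N_def bool_kernel_def simp flip: of_real_add) (auto simp: field_simps)
  qed
  have "val M = (1 + r) / 2"
  proof -
    have "r * (p / r) = p" "r * (e / r) = e" "p + e = 1" "(p / r)\<^sup>2 + (e / r)\<^sup>2 = 1"
      using r r2 by (auto simp: pe power_divide simp flip: add_divide_distrib)
    note helstrom_success_identity[OF this]
    then show ?thesis
      by (simp add: val UNIV_bool M_def N_def G pairing_slot_bool_kernel add.commute)
  qed
  then have "(SUP M \<in> {M. povm M}. val M) = (1 + r) / 2"
    using M upper by (intro cSup_eq_maximum) (auto intro: rev_image_eqI)
  then show ?thesis
    by (simp add: p_guess_def val_def r_def e_def)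
qed

text \<open>The first bound lets \<open>p ^ m\<close> be replaced by the larger
  \<open>g ^ (2 * m)\<close> in the binomial tail; the last one uses \<open>1 - p \<le> p\<close>
  and \<open>1/2 \<le> p\<close>.\<close>

lemma helstrom_bounds:
  fixes p :: real
  assumes "1 / 2 \<le> p" "p \<le> 1"
  defines "g \<equiv> (1 + sqrt (p\<^sup>2 + (1 - p)\<^sup>2)) / 2"
  shows "p \<le> g\<^sup>2" "0 \<le> g" "g \<le> 1" "g \<le> p * (1 + sqrt 2 * p)"
proof -
  define r where "r = sqrt (p\<^sup>2 + (1 - p)\<^sup>2)"
  have g: "g = (1 + r) / 2" by (simp add: g_def r_def)
  have r0: "0 \<le> r" by (simp add: r_def)
  have r2: "r\<^sup>2 = p\<^sup>2 + (1 - p)\<^sup>2" by (simp add: r_def)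
  then have r2': "r\<^sup>2 = 2 * p\<^sup>2 - 2 * p + 1" by (simp add: power2_eq_square algebra_simps)
  \<comment> \<open>This is \<open>p \<le> g\<^sup>2\<close> solved for \<open>r\<close>; the
    squares of the two sides differ by \<open>(1 - p)\<^sup>2 * p * (4 - p)\<close>.\<close>
  have "3 * p - 1 - p\<^sup>2 \<le> r"
  proof (rule power2_le_imp_le[OF _ r0])
    have "(1 - p)\<^sup>2 * (p * (4 - p)) \<ge> 0" using assms by simp
    then show "(3 * p - 1 - p\<^sup>2)\<^sup>2 \<le> r\<^sup>2"
      unfolding r2' by (simp add: power2_eq_square algebra_simps)
  qed
  then show "p \<le> g\<^sup>2"
    using r2' by (simp add: g power2_eq_square field_simps)
  show "0 \<le> g" using r0 by (simp add: g)
  have "p\<^sup>2 \<le> p" using assms by (simp add: power2_eq_square mult_left_le)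
  then have "r \<le> 1"
    using r2' by (intro power2_le_imp_le[of r 1]) auto
  then show "g \<le> 1" by (simp add: g)
  have "(1 - p)\<^sup>2 \<le> p\<^sup>2" using assms by (intro power_mono) auto
  then have r: "r \<le> sqrt 2 * p"
    using assms r2 by (intro power2_le_imp_le[of r]) (auto simp: power_mult_distrib)
  have "1 / 2 * (1 + sqrt 2 * p) \<le> p * (1 + sqrt 2 * p)"
    using assms by (intro mult_right_mono) (auto intro: add_nonneg_nonneg)
  then show "g \<le> p * (1 + sqrt 2 * p)" using r by (simp add: g)
qed

theorem lemma3:
  fixes p \<delta> \<epsilon> :: real
    and M :: "('q::finite \<Rightarrow> 'm::finite response)
               \<Rightarrow> ('q \<Rightarrow> 'n::finite challenge \<times> ('m \<Rightarrow> bool)) operator"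
    and x :: "'n challenge" and j :: 'm
  assumes "0 \<le> \<delta>" "\<delta> \<le> 1 / 2" "p = 1 / 2 + \<delta>"
    and "0 \<le> \<epsilon>" "\<epsilon> \<le> 1"
    and "CARD('q) \<le> 2 ^ CARD('n)"
    and "povm M"
  shows "p_extract p \<epsilon> M
           \<le> (\<Sum>k = nat \<lceil>(1 - \<epsilon>) * real CARD('q)\<rceil>..CARD('q).
                real (CARD('q) choose k) * p_guess p x j ^ (2 * CARD('m) * k)
                  * (1 - p_guess p x j ^ (2 * CARD('m))) ^ (CARD('q) - k))
         \<and> p_guess p x j \<le> p * (1 + sqrt 2 * p)"
proof
  let ?g = "p_guess p x j" and ?t = "nat \<lceil>(1 - \<epsilon>) * real CARD('q)\<rceil>"
  have p: "1 / 2 \<le> p" "p \<le> 1" using assms(1-3) by auto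
  note g = helstrom_bounds[OF p, folded p_guess_eq[OF p, of x j]]
  show "?g \<le> p * (1 + sqrt 2 * p)" by (rule g(4))
  have "p ^ CARD('m) \<le> ?g ^ (2 * CARD('m))"
    using g(1) p unfolding power_mult by (intro power_mono) auto
  moreover have "?g ^ (2 * CARD('m)) \<le> 1"
    using g by (intro power_le_one)
  \<comment> \<open>The binomial tail is monotone in its parameter: the real instance of the cone
    lemma, with total weight 1.\<close>
  ultimately have "threshold (UNIV :: 'q set) (\<lambda>_. 1) (\<lambda>_. p ^ CARD('m)) ?t
      \<le> threshold (UNIV :: 'q set) (\<lambda>_. 1) (\<lambda>_. ?g ^ (2 * CARD('m))) ?t"
    using nonneg.threshold_mono[of "UNIV :: 'q set" "\<lambda>_. p ^ CARD('m)" "\<lambda>_. ?g ^ (2 * CARD('m))" "\<lambda>_. 1" ?t] p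
    by simp
  with p_extract_le_threshold[OF p assms(6,7), of \<epsilon>]
  have "p_extract p \<epsilon> M \<le> threshold (UNIV :: 'q set) (\<lambda>_. 1) (\<lambda>_. ?g ^ (2 * CARD('m))) ?t"
    by linarith
  then show "p_extract p \<epsilon> M
           \<le> (\<Sum>k = ?t..CARD('q). real (CARD('q) choose k) * ?g ^ (2 * CARD('m) * k)
                  * (1 - ?g ^ (2 * CARD('m))) ^ (CARD('q) - k))"
    unfolding threshold_const power_mult .
qed

end
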